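(* For any $\delta\in(0,1]$ and $\beta\in[0,1/2)$ there exist constants $C=C(\delta,\beta)<\infty$ and $\alpha=\alpha(\delta,\beta)>0$ such that the following holds for every integer $n\ge 1$. If $\{M_i\}_{i\ge 0}$ is a discrete time real-valued martingale with respect to a filtration $\{\mathcal{F}_i\}_{i\ge 0}$ satisfying, for all $i\ge 0$, almost surely, $$E\big((M_{i+1}-M_i)^2\mid \mathcal{F}_i\big)\in[\delta,1]\qquad\text{and}\qquad |M_{i+1}-M_i|\le n^{\beta},$$ then $$\sup_{z\in\mathbb{R}} P\big(|M_n-z|\le n^{\beta}\big)< C\,n^{-\alpha}.$$
   Context: The constants $C,\alpha$ depend only on $\delta$ and $\beta$, and not on $n$ or on the martingale. *)

theory Defs
  imports "HOL-Probability.Probability" "HOL-Probability.Stopping_Time"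
begin

definition martingale :: "'a measure \<Rightarrow> (nat \<Rightarrow> 'a measure) \<Rightarrow> (nat \<Rightarrow> 'a \<Rightarrow> real) \<Rightarrow> bool" where
  "martingale P F M \<longleftrightarrow>
     prob_space P \<and> filtration (space P) F \<and> (\<forall>i. subalgebra P (F i)) \<and>
     (\<forall>i. M i \<in> borel_measurable (F i)) \<and>
     (\<forall>i. integrable P (M i)) \<and>
     (\<forall>i. AE \<omega> in P. real_cond_exp P (F i) (M (Suc i)) \<omega> = M i \<omega>)"

definition controlled_martingale ::
  "real \<Rightarrow> real \<Rightarrow> nat \<Rightarrow> 'a measure \<Rightarrow> (nat \<Rightarrow> 'a measure) \<Rightarrow> (nat \<Rightarrow> 'a \<Rightarrow> real) \<Rightarrow> bool" where
  "controlled_martingale \<delta> \<beta> n P F M \<longleftrightarrow>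
     martingale P F M \<and>
     (\<forall>i. AE \<omega> in P. real_cond_exp P (F i) (\<lambda>\<omega>. (M (Suc i) \<omega> - M i \<omega>)\<^sup>2) \<omega> \<in> {\<delta>..1}) \<and>
     (\<forall>i. AE \<omega> in P. \<bar>M (Suc i) \<omega> - M i \<omega>\<bar> \<le> real n powr \<beta>)"

definition localization_bound :: "'a itself \<Rightarrow> real \<Rightarrow> real \<Rightarrow> real \<Rightarrow> real \<Rightarrow> bool" where
  "localization_bound _ \<delta> \<beta> C \<alpha> \<longleftrightarrow>
     (\<forall>n\<ge>1. \<forall>(P :: 'a measure) F M. controlled_martingale \<delta> \<beta> n P F M \<longrightarrow>
        (SUP z::real. measure P {\<omega> \<in> space P. \<bar>M n \<omega> - z\<bar> \<le> real n powr \<beta>})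
          < C * real n powr (- \<alpha>))"

text \<open>
  One pair of constants has to serve every probability space, but a formula of HOL cannot choose the
  constants first and then quantify over the type \<open>'a\<close> of sample points: in
  \<open>\<exists>C \<alpha>. 0 < \<alpha> \<and> localization_bound TYPE('a) \<delta> \<beta> C \<alpha>\<close> they could depend on
  \<open>'a\<close>. To exclude this, assert that constants exist for the sample points
  \<open>nat \<Rightarrow> real\<close> (the path space of a real process), and that any constants valid there
  are valid for every type \<open>'a\<close>.
\<close>

end

theory Submission
  imports Defs
begin

text \<open>
  With \<open>\<alpha> = \<delta> / 256\<close>, the function \<open>u(s, x) = s\<^sup>1\<^sup>-\<^sup>\<alpha> / (128 s + x\<^sup>2)\<close> is a strict
  supersolution of \<open>\<partial>\<^sub>s u = sup {a u\<^sub>x\<^sub>x / 2 | a \<in> [\<delta>, 1]}\<close>. Its tails are polynomial, so, unlike for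
  the Gaussian supersolutions, the slack absorbs the Taylor remainder for jumps of size at most \<open>K\<close>
  uniformly in \<open>x\<close> as soon as \<open>K\<^sup>2 \<le> \<delta> s\<close>. Hence \<open>E u(s, M\<^sub>j\<^sub>+\<^sub>1 - z) \<le> E u(s + 1, M\<^sub>j - z)\<close>, and
  iterating from \<open>s = K\<^sup>2 / \<delta>\<close>, where \<open>K\<close> is the jump bound \<open>n\<^sup>\<beta>\<close>, gives
  \<open>E u(s, M\<^sub>n - z) \<le> (s + n)\<^sup>-\<^sup>\<alpha> / 128\<close>. Since \<open>u(s, x) \<ge> s\<^sup>-\<^sup>\<alpha> / 129\<close> for \<open>\<bar>x\<bar> \<le> K\<close>, Markov's inequality
  yields a bound of order \<open>(s / n)\<^sup>\<alpha>\<close>, that is \<open>n\<close> to the power \<open>- (1 - 2\<beta>) \<alpha>\<close>.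

  Constants valid on the path space are valid everywhere because the law of the path, with the
  filtration generated by the coordinates, is again a controlled martingale: the bounds on
  the conditional variance survive passing to a coarser filtration.
\<close>

section \<open>A space-time supersolution\<close>

text \<open>Self-similar: it equals \<open>s powr (- \<alpha>)\<close> times a function of x / sqrt
  s, a Cauchy-type profile in x. The variable s plays the role of an offset plus the number of steps
  still to run. The weight 128 is what makes the remainder estimates below close.\<close>

definition supersol :: "real \<Rightarrow> real \<Rightarrow> real \<Rightarrow> real" where
  "supersol \<alpha> s x = s powr (1 - \<alpha>) / (128 * s + x\<^sup>2)"

text \<open>Second-order expansion of 1 / (D + h) around D with an exact remainder. That remainder
  keeps a factor \<open>\<xi>\<^sup>2\<close>, so that after conditioning it is controlled by the
  conditional variance.\<close>

lemma inverse_quadratic_shift_le: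
  fixes L K x \<xi> :: real
  assumes "0 < L" and "6 * K\<^sup>2 \<le> L" and "\<bar>\<xi>\<bar> \<le> K"
  defines "D \<equiv> L + x\<^sup>2"
  shows "1 / (L + (x + \<xi>)\<^sup>2) \<le> 1 / D - (2 * x * \<xi> + \<xi>\<^sup>2) / D\<^sup>2 + \<xi>\<^sup>2 * (16 * x\<^sup>2 + 4 * K\<^sup>2) / D ^ 3"
proof -
  define h where "h = 2 * x * \<xi> + \<xi>\<^sup>2"
  have D: "0 < D" using assms by (simp add: add_pos_nonneg)
  have \<xi>K: "\<xi>\<^sup>2 \<le> K\<^sup>2" using assms(3) by (simp add: abs_le_square_iff[symmetric])
  have split: "L + (x + \<xi>)\<^sup>2 = D + h" by (simp add: D_def h_def power2_sum)
  \<comment> \<open>This square bounds the cross term: \<open>2 * x * \<xi>\<close> is at least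
    \<open>- x\<^sup>2 / 2 - 2 * \<xi>\<^sup>2\<close>. Hence the shift removes at most half of
    \<open>D\<close>.\<close>
  have "0 \<le> (x + 2 * \<xi>)\<^sup>2" by simp
  hence "0 \<le> x\<^sup>2 + 4 * (x * \<xi>) + 4 * \<xi>\<^sup>2" by (simp add: power2_sum power_mult_distrib)
  hence half: "D / 2 \<le> D + h"
    using assms(2) \<xi>K zero_le_power2[of \<xi>] by (simp only: D_def h_def mult.assoc) argo
  hence Dh: "0 < D + h" using D by linarith
  have "0 \<le> (2 * x - \<xi>)\<^sup>2" by simp
  hence "(2 * x + \<xi>)\<^sup>2 \<le> 8 * x\<^sup>2 + 2 * K\<^sup>2"
    using \<xi>K by (simp add: power2_sum power2_diff power_mult_distrib)
  moreover have "h\<^sup>2 = \<xi>\<^sup>2 * (2 * x + \<xi>)\<^sup>2" by (simp add: h_def power2_eq_square algebra_simps)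
  ultimately have h2: "h\<^sup>2 \<le> \<xi>\<^sup>2 * (8 * x\<^sup>2 + 2 * K\<^sup>2)" by (simp add: mult_left_mono)
  \<comment> \<open>Exact identity; only the last summand is estimated, and replacing
    \<open>D + h\<close> by \<open>D / 2\<close> doubles the coefficients 8 and 2 to 16 and
    4.\<close>
  have "1 / (D + h) = 1 / D - h / D\<^sup>2 + h\<^sup>2 / (D\<^sup>2 * (D + h))"
    using D Dh by (simp add: divide_simps) (simp add: algebra_simps power2_eq_square)
  also have "h\<^sup>2 / (D\<^sup>2 * (D + h)) \<le> \<xi>\<^sup>2 * (8 * x\<^sup>2 + 2 * K\<^sup>2) / (D\<^sup>2 * (D / 2))"
    using D Dh h2 half by (intro frac_le mult_left_mono) auto
  also have "\<dots> = \<xi>\<^sup>2 * (16 * x\<^sup>2 + 4 * K\<^sup>2) / D ^ 3"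
    using D by (simp add: field_simps power2_eq_square power3_eq_cube)
  finally show ?thesis by (simp add: split h_def)
qed

text \<open>From ln (1 + 1/s) \<le> 1/s and exp t \<ge> 1 + t one gets
  \<open>1 - \<alpha> / s \<le> (1 + 1 / s) powr (- \<alpha>)\<close>. This turns the comparison of
  powers at s and s + 1 into a rational inequality.\<close>

lemma powr_one_minus_step:
  fixes s \<alpha> :: real
  assumes "0 < s" and "0 \<le> \<alpha>"
  shows "s powr (- \<alpha>) * ((s + 1) * (1 - \<alpha> / s)) \<le> (s + 1) powr (1 - \<alpha>)"
proof -
  have "1 - \<alpha> / s \<le> exp (- \<alpha> / s)"
    using exp_ge_add_one_self[of "- \<alpha> / s"] by simp
  also have "\<dots> \<le> exp (- \<alpha> * ln (1 + 1 / s))"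
    using assms ln_add_one_self_le_self[of "1 / s"] mult_left_mono[of "ln (1 + 1 / s)" "1 / s" \<alpha>] by simp
  also have "\<dots> = (1 + 1 / s) powr (- \<alpha>)"
    using assms by (simp add: powr_def add_pos_pos less_imp_neq[symmetric])
  finally have "s powr (- \<alpha>) * (1 - \<alpha> / s) \<le> s powr (- \<alpha>) * (1 + 1 / s) powr (- \<alpha>)"
    by (intro mult_left_mono) auto
  also have "\<dots> = (s + 1) powr (- \<alpha>)"
    using assms by (simp add: powr_mult[symmetric] distrib_left)
  finally have "(s + 1) * (s powr (- \<alpha>) * (1 - \<alpha> / s)) \<le> (s + 1) * (s + 1) powr (- \<alpha>)"
    using assms by (intro mult_left_mono) auto
  also have "\<dots> = (s + 1) powr (1 - \<alpha>)"
    using assms powr_add[of "s + 1" 1 "- \<alpha>"] by simp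
  finally show ?thesis by (simp add: algebra_simps)
qed

text \<open>After division by s / D there are two gains: \<delta> / D from diffusion, effective for
  small x, and a term of order \<open>x\<^sup>2 / (s * D)\<close> from the growth of s, effective
  for large x. Together they pay for the Taylor remainder and for the loss \<alpha> / s caused by
  the exponent.\<close>

lemma supersol_rational_step:
  fixes s \<delta> K x :: real
  assumes "1 \<le> s" and "0 < \<delta>" and "\<delta> \<le> 1" and "K\<^sup>2 \<le> \<delta> * s"
  defines "D \<equiv> 128 * s + x\<^sup>2" and "\<alpha> \<equiv> \<delta> / 256"
  shows "s * (1 / D - \<delta> / D\<^sup>2 + (16 * x\<^sup>2 + 4 * K\<^sup>2) / D ^ 3)
    \<le> (s + 1) * (1 - \<alpha> / s) / (128 * (s + 1) + x\<^sup>2)"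
proof -
  have D: "128 \<le> D" "128 * s \<le> D" using assms by (auto simp: D_def intro: order_trans[of _ "128 * s"])
  hence Dpos: "0 < D" by linarith
  have spos: "0 < s" using assms by linarith
  have \<alpha>: "0 \<le> \<alpha>" "\<alpha> \<le> 1/2" using assms by (auto simp: \<alpha>_def)
  have \<alpha>s: "\<alpha> / s \<le> 1/2" using \<alpha> assms(1) by (simp add: field_simps)
  have "16 * x\<^sup>2 / D\<^sup>2 \<le> x\<^sup>2 / (8 * s * D)"
  proof -
    have "16 * x\<^sup>2 / D\<^sup>2 = 16 * x\<^sup>2 / (D * D)" by (simp add: power2_eq_square)
    also have "\<dots> \<le> 16 * x\<^sup>2 / (128 * s * D)"
      using D Dpos spos by (intro divide_left_mono mult_right_mono) auto
    finally show ?thesis by (simp add: ac_simps)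
  qed
  moreover have "4 * K\<^sup>2 / D\<^sup>2 \<le> \<delta> / (2 * D)"
  proof -
    have "4 * K\<^sup>2 / D\<^sup>2 \<le> 4 * (\<delta> * s) / D\<^sup>2" using assms(4) by (intro divide_right_mono) auto
    also have "\<dots> \<le> (\<delta> * D / 2) / D\<^sup>2"
      using D(2) spos assms(2) by (intro divide_right_mono) (auto simp: mult_left_mono field_simps)
    also have "\<dots> = \<delta> / (2 * D)" using Dpos by (simp add: power2_eq_square)
    finally show ?thesis .
  qed
  \<comment> \<open>The choice of \<alpha> makes 128 \<alpha> equal to \<delta> / 2, so the part 128
    s of \<open>D\<close> is paid by the half of the diffusion gain that the jump remainder leaves
    over.\<close>
  moreover have "\<alpha> / s \<le> x\<^sup>2 / (8 * s * D) + \<delta> / (2 * D)"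
  proof -
    have "\<delta> * x\<^sup>2 \<le> 1 * x\<^sup>2" using assms(3) by (intro mult_right_mono) auto
    hence "\<delta> * x\<^sup>2 \<le> 32 * x\<^sup>2" using zero_le_power2[of x] by linarith
    hence "\<alpha> * D \<le> x\<^sup>2 / 8 + \<delta> * s / 2"
      unfolding \<alpha>_def D_def by (simp add: algebra_simps)
    thus ?thesis using Dpos spos by (simp add: field_simps)
  qed
  ultimately have main: "1 - \<delta> / D + (16 * x\<^sup>2 + 4 * K\<^sup>2) / D\<^sup>2 \<le> 1 - \<alpha> / s + x\<^sup>2 / (4 * s * D)"
    by (simp add: add_divide_distrib)
  \<comment> \<open>One factor 1/2 absorbs \<open>D + 128 \<le> 2 * D\<close>, the other absorbs
    \<open>1 - \<alpha> / s \<ge> 1/2\<close>. Here \<open>D + 128\<close> is the denominator at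
    time s + 1.\<close>
  have "x\<^sup>2 / (4 * s * D) = x\<^sup>2 / (s * (2 * D)) * (1/2)" by simp
  also have "\<dots> \<le> x\<^sup>2 / (s * (D + 128)) * (1 - \<alpha> / s)"
    using D Dpos spos \<alpha>s by (intro mult_mono divide_left_mono) (auto intro!: mult_pos_pos)
  finally have "1 - \<delta> / D + (16 * x\<^sup>2 + 4 * K\<^sup>2) / D\<^sup>2
      \<le> (1 + x\<^sup>2 / (s * (D + 128))) * (1 - \<alpha> / s)"
    using main by (simp add: algebra_simps)
  hence "s / D * (1 - \<delta> / D + (16 * x\<^sup>2 + 4 * K\<^sup>2) / D\<^sup>2)
      \<le> s / D * ((1 + x\<^sup>2 / (s * (D + 128))) * (1 - \<alpha> / s))"
    using Dpos spos by (intro mult_left_mono) auto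
  also have "s / D * (1 + x\<^sup>2 / (s * (D + 128))) = (s + 1) / (D + 128)"
  proof -
    have "s * (D + 128) + x\<^sup>2 = (s + 1) * D" by (simp add: D_def algebra_simps)
    moreover have "1 + x\<^sup>2 / (s * (D + 128)) = (s * (D + 128) + x\<^sup>2) / (s * (D + 128))"
      using Dpos spos by (simp add: add_divide_distrib)
    ultimately show ?thesis using Dpos spos by simp
  qed
  hence "s / D * ((1 + x\<^sup>2 / (s * (D + 128))) * (1 - \<alpha> / s)) = (s + 1) / (D + 128) * (1 - \<alpha> / s)"
    by (metis mult.assoc)
  also have "s / D * (1 - \<delta> / D + (16 * x\<^sup>2 + 4 * K\<^sup>2) / D\<^sup>2)
      = s * (1 / D - \<delta> / D\<^sup>2 + (16 * x\<^sup>2 + 4 * K\<^sup>2) / D ^ 3)"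
    by (simp add: algebra_simps add_divide_distrib power2_eq_square power3_eq_cube)
  also have "D + 128 = 128 * (s + 1) + x\<^sup>2" by (simp add: D_def)
  finally show ?thesis by simp
qed

text \<open>The left side is the expansion of \<open>supersol\<close> with the conditional variance
  replaced by its worst values: \<delta> in the negative term and 1 in the remainder.\<close>

lemma supersol_step:
  fixes s \<delta> K x :: real
  assumes "1 \<le> s" and "0 < \<delta>" and "\<delta> \<le> 1" and "K\<^sup>2 \<le> \<delta> * s"
  defines "D \<equiv> 128 * s + x\<^sup>2" and "\<alpha> \<equiv> \<delta> / 256"
  shows "s powr (1 - \<alpha>) * (1 / D - \<delta> / D\<^sup>2 + (16 * x\<^sup>2 + 4 * K\<^sup>2) / D ^ 3)
    \<le> supersol \<alpha> (s + 1) x"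
proof -
  have "s powr (1 - \<alpha>) = s powr (- \<alpha>) * s"
    using assms(1) powr_add[of s "- \<alpha>" 1] by simp
  hence "s powr (1 - \<alpha>) * (1 / D - \<delta> / D\<^sup>2 + (16 * x\<^sup>2 + 4 * K\<^sup>2) / D ^ 3)
      = s powr (- \<alpha>) * (s * (1 / D - \<delta> / D\<^sup>2 + (16 * x\<^sup>2 + 4 * K\<^sup>2) / D ^ 3))"
    by (simp only: mult.assoc)
  also have "\<dots> \<le> s powr (- \<alpha>) * ((s + 1) * (1 - \<alpha> / s) / (128 * (s + 1) + x\<^sup>2))"
    unfolding D_def \<alpha>_def using assms by (intro mult_left_mono supersol_rational_step) auto
  also have "\<dots> = s powr (- \<alpha>) * ((s + 1) * (1 - \<alpha> / s)) / (128 * (s + 1) + x\<^sup>2)"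
    by simp
  also have "\<dots> \<le> (s + 1) powr (1 - \<alpha>) / (128 * (s + 1) + x\<^sup>2)"
    using assms by (intro divide_right_mono powr_one_minus_step) auto
  finally show ?thesis by (simp add: supersol_def)
qed

section \<open>Size of the supersolution: global upper bound and lower bound near the origin\<close>

lemma supersol_nonneg: "0 < s \<Longrightarrow> 0 \<le> supersol \<alpha> s x"
  by (simp add: supersol_def)

lemma supersol_le:
  assumes "0 < s"
  shows "supersol \<alpha> s x \<le> s powr (- \<alpha>) / 128"
proof -
  have "supersol \<alpha> s x \<le> s powr (1 - \<alpha>) / (128 * s)"
    unfolding supersol_def using assms by (intro divide_left_mono) (auto intro!: mult_pos_pos add_pos_nonneg)
  also have "\<dots> = s powr (- \<alpha>) / 128"
    using assms powr_add[of s "- \<alpha>" 1] by simp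
  finally show ?thesis .
qed

lemma supersol_ge:
  assumes "0 < s" and "x\<^sup>2 \<le> s"
  shows "s powr (- \<alpha>) / 129 \<le> supersol \<alpha> s x"
proof -
  have "s powr (- \<alpha>) / 129 = s powr (1 - \<alpha>) / (129 * s)"
    using assms powr_add[of s "- \<alpha>" 1] by simp
  also have "\<dots> \<le> supersol \<alpha> s x"
    unfolding supersol_def using assms by (intro divide_left_mono) (auto intro!: mult_pos_pos add_pos_nonneg)
  finally show ?thesis .
qed

lemma supersol_measurable [measurable]: "supersol \<alpha> s \<in> borel_measurable borel"
  unfolding supersol_def by measurable

section \<open>Decay along a controlled martingale\<close>

text \<open>The event that the first conditional expectation exceeds the second lies in
  \<open>F\<close>, and the difference has nonpositive integral over it, so it is null. Comparing
  integrals over sets of \<open>F\<close> is enough, which serves when f and g are not ordered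
  pointwise.\<close>

lemma (in sigma_finite_subalgebra) real_cond_exp_mono_set:
  assumes [measurable]: "integrable M f" "integrable M g"
    and le: "\<And>A. A \<in> sets F \<Longrightarrow> (\<integral>x\<in>A. f x \<partial>M) \<le> (\<integral>x\<in>A. g x \<partial>M)"
  shows "AE x in M. real_cond_exp M F f x \<le> real_cond_exp M F g x"
proof -
  define d where "d = (\<lambda>x. real_cond_exp M F f x - real_cond_exp M F g x)"
  define A where "A = {x \<in> space F. 0 < d x}"
  have [measurable]: "d \<in> borel_measurable F" unfolding d_def by measurable
  have A: "A \<in> sets F" unfolding A_def by measurable
  hence AM: "A \<in> sets M" using subalg by (auto simp: subalgebra_def)
  have sp: "space F = space M" using subalg by (simp add: subalgebra_def)
  have int: "integrable M d" unfolding d_def using assms by (intro Bochner_Integration.integrable_diff real_cond_exp_int) auto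
  hence intA: "integrable M (\<lambda>x. indicator A x * d x)"
    using integrable_mult_indicator[OF AM int] by simp
  have si: "set_integrable M A (real_cond_exp M F f)" "set_integrable M A (real_cond_exp M F g)"
    unfolding set_integrable_def by (intro integrable_mult_indicator[OF AM] real_cond_exp_int assms(1,2))+
  have "(\<integral>x. indicator A x * d x \<partial>M) = (\<integral>x\<in>A. real_cond_exp M F f x \<partial>M) - (\<integral>x\<in>A. real_cond_exp M F g x \<partial>M)"
    using set_integral_diff(2)[OF si] by (simp add: set_lebesgue_integral_def d_def)
  also have "\<dots> = (\<integral>x\<in>A. f x \<partial>M) - (\<integral>x\<in>A. g x \<partial>M)"
    using A assms by (simp add: real_cond_exp_intA)
  also have "\<dots> \<le> 0" using le[OF A] by simp
  finally have "(\<integral>x. indicator A x * d x \<partial>M) \<le> 0" .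
  moreover have nn: "AE x in M. 0 \<le> indicator A x * d x"
    by (auto simp: A_def indicator_def)
  ultimately have "(\<integral>x. indicator A x * d x \<partial>M) = 0"
    using integral_nonneg_AE[OF nn] by linarith
  hence "AE x in M. indicator A x * d x = 0"
    using integral_nonneg_eq_0_iff_AE[OF intA nn] by simp
  thus ?thesis
    using AE_space by eventually_elim (auto simp: A_def d_def indicator_def sp split: if_splits)
qed

text \<open>Expand in the increment: the linear term has mean zero, the quadratic term sees only the
  conditional variance, and the resulting pointwise bound is the supersolution one time unit
  later.\<close>

lemma (in finite_measure_subalgebra) supersol_expectation_step:
  fixes X \<xi> :: "'a \<Rightarrow> real"
  assumes [measurable]: "X \<in> borel_measurable F" "\<xi> \<in> borel_measurable M"
    and bd: "AE x in M. \<bar>\<xi> x\<bar> \<le> K"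
    and mean: "AE x in M. real_cond_exp M F \<xi> x = 0"
    and var: "AE x in M. real_cond_exp M F (\<lambda>x. (\<xi> x)\<^sup>2) x \<in> {\<delta>..1}"
    and s: "1 \<le> s" "0 < \<delta>" "\<delta> \<le> 1" "K\<^sup>2 \<le> \<delta> * s"
  shows "(\<integral>x. supersol (\<delta> / 256) s (X x + \<xi> x) \<partial>M) \<le> (\<integral>x. supersol (\<delta> / 256) (s + 1) (X x) \<partial>M)"
proof -
  define D where "D = (\<lambda>x. 128 * s + (X x)\<^sup>2)"
  define c where "c = s powr (1 - \<delta> / 256)"
  \<comment> \<open>\<open>a\<close> and \<open>b\<close> are the coefficients of
    \<open>\<xi>\<close> and its square in the expansion. Being \<open>F\<close>-measurable, they
    can be pulled out of conditional expectations.\<close>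
  define a where "a = (\<lambda>x. - (2 * X x) / (D x)\<^sup>2)"
  define b where "b = (\<lambda>x. (16 * (X x)\<^sup>2 + 4 * K\<^sup>2) / (D x) ^ 3 - 1 / (D x)\<^sup>2)"
  have [measurable]: "X \<in> borel_measurable M" by (rule measurable_from_subalg[OF subalg]) fact
  have aF [measurable]: "a \<in> borel_measurable F" and bF [measurable]: "b \<in> borel_measurable F"
    unfolding a_def b_def D_def by measurable
  have [measurable]: "a \<in> borel_measurable M" "b \<in> borel_measurable M"
    by (auto intro: measurable_from_subalg[OF subalg])
  have [measurable]: "D \<in> borel_measurable M" unfolding D_def by measurable
  have D1: "1 \<le> D x" and DX: "(X x)\<^sup>2 \<le> D x" for x
    using s(1) zero_le_power2[of "X x"] unfolding D_def by linarith+
  have Dpos: "0 < D x" for x using D1[of x] by linarith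
  \<comment> \<open>Crude bounds on both coefficients; with the bounded increment they give
    integrability of the products.\<close>
  have a_bd: "\<bar>a x\<bar> \<le> 2" for x
  proof -
    have "0 \<le> (\<bar>X x\<bar> - 1)\<^sup>2" by simp
    hence "\<bar>2 * X x\<bar> \<le> (X x)\<^sup>2 + 1" by (simp add: power2_diff abs_mult)
    also have "\<dots> \<le> 2 * D x" using D1[of x] DX[of x] by simp
    also have "\<dots> \<le> 2 * (D x)\<^sup>2" using D1[of x] by (simp add: power2_eq_square)
    finally show ?thesis using Dpos[of x] by (simp add: a_def field_simps abs_mult)
  qed
  have b_bd: "\<bar>b x\<bar> \<le> 17 + 4 * K\<^sup>2" for x
  proof -
    have "(16 * (X x)\<^sup>2 + 4 * K\<^sup>2) \<le> 16 * D x + 4 * K\<^sup>2 * D x"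
      using D1[of x] DX[of x] by (intro add_mono mult_left_mono) (auto simp: mult_le_cancel_left1)
    also have "\<dots> = (16 + 4 * K\<^sup>2) * (D x * 1)" by (simp add: algebra_simps)
    also have "\<dots> \<le> (16 + 4 * K\<^sup>2) * (D x * (D x)\<^sup>2)"
      using D1[of x] by (intro mult_left_mono) (auto simp: one_le_power)
    finally have "(16 * (X x)\<^sup>2 + 4 * K\<^sup>2) / (D x) ^ 3 \<le> 16 + 4 * K\<^sup>2"
      using Dpos[of x] by (simp add: pos_divide_le_eq power3_eq_cube power2_eq_square mult.assoc)
    moreover have "0 \<le> (16 * (X x)\<^sup>2 + 4 * K\<^sup>2) / (D x) ^ 3" using Dpos[of x] by simp
    moreover have "0 \<le> 1 / (D x)\<^sup>2" "1 / (D x)\<^sup>2 \<le> 1" using D1[of x] by (auto simp: one_le_power)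
    ultimately show ?thesis unfolding b_def by linarith
  qed
  have sq_bd: "AE x in M. (\<xi> x)\<^sup>2 \<le> K\<^sup>2"
    using bd by eventually_elim (metis abs_le_square_iff abs_ge_self order_trans)
  have int_a: "integrable M (\<lambda>x. a x * \<xi> x)"
  proof (rule integrable_const_bound)
    show "AE x in M. norm (a x * \<xi> x) \<le> 2 * K"
      using bd by eventually_elim (auto simp: abs_mult intro!: mult_mono a_bd)
  qed measurable
  have int_b: "integrable M (\<lambda>x. b x * (\<xi> x)\<^sup>2)"
  proof (rule integrable_const_bound)
    show "AE x in M. norm (b x * (\<xi> x)\<^sup>2) \<le> (17 + 4 * K\<^sup>2) * K\<^sup>2"
      using sq_bd by eventually_elim (auto simp: abs_mult intro!: mult_mono b_bd)
  qed measurable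
  have int_0: "integrable M (\<lambda>x. 1 / D x)"
    using D1 Dpos by (intro integrable_const_bound[where B = 1]) (auto simp: less_imp_le)
  have int_u: "integrable M (\<lambda>x. supersol (\<delta> / 256) t (Y x))"
    if "1 \<le> t" and [measurable]: "Y \<in> borel_measurable M" for t Y
    using that supersol_nonneg[of t "\<delta> / 256"] supersol_le[of t "\<delta> / 256"]
    by (intro integrable_const_bound[where B = "t powr (- (\<delta> / 256)) / 128"]) auto
  define V where "V = real_cond_exp M F (\<lambda>x. (\<xi> x)\<^sup>2)"
  have int_bV: "integrable M (\<lambda>x. b x * V x)"
    and eq_b: "(\<integral>x. b x * V x \<partial>M) = (\<integral>x. b x * (\<xi> x)\<^sup>2 \<partial>M)"
    unfolding V_def using int_b by (intro real_cond_exp_intg; measurable)+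
  have "(\<integral>x. a x * \<xi> x \<partial>M) = (\<integral>x. a x * real_cond_exp M F \<xi> x \<partial>M)"
    using int_a by (intro real_cond_exp_intg(2)[symmetric]) auto
  also have "\<dots> = (\<integral>x. 0 \<partial>M)"
    using mean by (intro integral_cong_AE) auto
  finally have eq_a: "(\<integral>x. a x * \<xi> x \<partial>M) = 0" by simp
  have K2: "6 * K\<^sup>2 \<le> 128 * s"
    using s mult_right_mono[of \<delta> 1 s] by linarith
  have "AE x in M. supersol (\<delta> / 256) s (X x + \<xi> x) \<le> c * (1 / D x + a x * \<xi> x + b x * (\<xi> x)\<^sup>2)"
    using bd
  proof eventually_elim
    case (elim x)
    have "1 / (128 * s + (X x + \<xi> x)\<^sup>2) \<le> 1 / D x + a x * \<xi> x + b x * (\<xi> x)\<^sup>2"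
      using inverse_quadratic_shift_le[of "128 * s" K "\<xi> x" "X x"] elim s(1) K2
      by (simp add: D_def a_def b_def algebra_simps diff_divide_distrib add_divide_distrib)
    hence "c * (1 / (128 * s + (X x + \<xi> x)\<^sup>2)) \<le> c * (1 / D x + a x * \<xi> x + b x * (\<xi> x)\<^sup>2)"
      by (intro mult_left_mono) (auto simp: c_def)
    thus ?case by (simp add: supersol_def c_def)
  qed
  hence "(\<integral>x. supersol (\<delta> / 256) s (X x + \<xi> x) \<partial>M)
      \<le> (\<integral>x. c * (1 / D x + a x * \<xi> x + b x * (\<xi> x)\<^sup>2) \<partial>M)"
    using s int_0 int_a int_b by (intro integral_mono_AE int_u) auto
  also have "\<dots> = c * ((\<integral>x. 1 / D x \<partial>M) + (\<integral>x. a x * \<xi> x \<partial>M) + (\<integral>x. b x * (\<xi> x)\<^sup>2 \<partial>M))"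
    using int_0 int_a int_b by simp
  also have "\<dots> = c * ((\<integral>x. 1 / D x \<partial>M) + (\<integral>x. b x * V x \<partial>M))"
    by (simp add: eq_a eq_b)
  also have "\<dots> = (\<integral>x. c * (1 / D x + b x * V x) \<partial>M)"
    using int_0 int_bV by simp
  also have "\<dots> \<le> (\<integral>x. supersol (\<delta> / 256) (s + 1) (X x) \<partial>M)"
  proof (intro integral_mono_AE int_u)
    show "integrable M (\<lambda>x. c * (1 / D x + b x * V x))" using int_0 int_bV by simp
    show "AE x in M. c * (1 / D x + b x * V x) \<le> supersol (\<delta> / 256) (s + 1) (X x)"
      using var
    proof eventually_elim
      case (elim x)
      have V: "\<delta> \<le> V x" "V x \<le> 1" using elim by (auto simp: V_def)
      define q where "q = (16 * (X x)\<^sup>2 + 4 * K\<^sup>2) / (D x) ^ 3"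
      have q: "0 \<le> q" using Dpos[of x] by (simp add: q_def)
      \<comment> \<open>The sign of \<open>b x\<close> varies, so its two parts are treated
        separately: \<open>V x \<le> 1\<close> bounds the positive one and
        \<open>\<delta> \<le> V x\<close> the negative one.\<close>
      have "b x * V x = q * V x - V x / (D x)\<^sup>2" by (simp add: b_def q_def algebra_simps)
      also have "\<dots> \<le> q - \<delta> / (D x)\<^sup>2"
        using V q by (intro diff_mono divide_right_mono) (auto simp: mult_left_le)
      finally have "c * (1 / D x + b x * V x) \<le> c * (1 / D x - \<delta> / (D x)\<^sup>2 + q)"
        by (intro mult_left_mono) (auto simp: c_def)
      also have "\<dots> \<le> supersol (\<delta> / 256) (s + 1) (X x)"
        unfolding c_def q_def D_def using s by (intro supersol_step) auto
      finally show ?case .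
    qed
  qed (use s in auto)
  finally show ?thesis .
qed

section \<open>Iteration over the steps of a controlled martingale\<close>

lemma martingale_finite_measure_subalgebra:
  "martingale P F M \<Longrightarrow> finite_measure_subalgebra P (F i)"
  by (simp add: martingale_def finite_measure_subalgebra_def finite_measure_subalgebra_axioms_def
      prob_space.finite_measure)

lemma martingale_borel_measurable:
  "martingale P F M \<Longrightarrow> M i \<in> borel_measurable P"
  by (auto simp: martingale_def)

lemma martingale_increment_cond_exp:
  assumes "martingale P F M"
  shows "AE \<omega> in P. real_cond_exp P (F i) (\<lambda>\<omega>. M (Suc i) \<omega> - M i \<omega>) \<omega> = 0"
proof -
  interpret finite_measure_subalgebra P "F i" using assms by (rule martingale_finite_measure_subalgebra)
  have "AE \<omega> in P. real_cond_exp P (F i) (\<lambda>\<omega>. M (Suc i) \<omega> - M i \<omega>) \<omega>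
      = real_cond_exp P (F i) (M (Suc i)) \<omega> - real_cond_exp P (F i) (M i) \<omega>"
    using assms by (intro real_cond_exp_diff) (auto simp: martingale_def)
  moreover have "AE \<omega> in P. real_cond_exp P (F i) (M i) \<omega> = M i \<omega>"
    using assms by (intro real_cond_exp_F_meas) (auto simp: martingale_def)
  moreover have "AE \<omega> in P. real_cond_exp P (F i) (M (Suc i)) \<omega> = M i \<omega>"
    using assms by (auto simp: martingale_def)
  ultimately show ?thesis by eventually_elim simp
qed

text \<open>Induction on j with s arbitrary: each step trades one martingale step for one unit of s,
  and the conditions on s survive its growth. At j = 0 only the global upper bound in x is used, so
  neither z nor the initial law matters.\<close>

lemma controlled_martingale_supersol_expectation:
  assumes cm: "controlled_martingale \<delta> \<beta> n P F M"
    and \<delta>: "0 < \<delta>" "\<delta> \<le> 1"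
    and s: "1 \<le> s" "(real n powr \<beta>)\<^sup>2 \<le> \<delta> * s"
  shows "(\<integral>\<omega>. supersol (\<delta> / 256) s (M j \<omega> - z) \<partial>P) \<le> (s + real j) powr (- (\<delta> / 256)) / 128"
  using s
proof (induction j arbitrary: s)
  case 0
  have mart: "martingale P F M" using cm by (simp add: controlled_martingale_def)
  interpret prob_space P using mart by (simp add: martingale_def)
  note [measurable] = martingale_borel_measurable[OF mart]
  have b: "0 \<le> supersol (\<delta> / 256) s (M 0 \<omega> - z)"
    "supersol (\<delta> / 256) s (M 0 \<omega> - z) \<le> s powr (- (\<delta> / 256)) / 128" for \<omega>
    using 0 by (auto intro!: supersol_nonneg supersol_le simp del: le_divide_eq_numeral1)
  have "integrable P (\<lambda>\<omega>. supersol (\<delta> / 256) s (M 0 \<omega> - z))"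
    using b by (intro integrable_const_bound[where B = "s powr (- (\<delta> / 256)) / 128"]) auto
  hence "(\<integral>\<omega>. supersol (\<delta> / 256) s (M 0 \<omega> - z) \<partial>P) \<le> (\<integral>\<omega>. s powr (- (\<delta> / 256)) / 128 \<partial>P)"
    using b by (intro integral_mono) auto
  thus ?case by (simp add: prob_space)
next
  case (Suc j)
  have mart: "martingale P F M" using cm by (simp add: controlled_martingale_def)
  interpret finite_measure_subalgebra P "F j" using mart by (rule martingale_finite_measure_subalgebra)
  note [measurable] = martingale_borel_measurable[OF mart]
  have [measurable]: "M j \<in> borel_measurable (F j)" using mart by (auto simp: martingale_def)
  have "(\<integral>\<omega>. supersol (\<delta> / 256) s ((M j \<omega> - z) + (M (Suc j) \<omega> - M j \<omega>)) \<partial>P)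
      \<le> (\<integral>\<omega>. supersol (\<delta> / 256) (s + 1) (M j \<omega> - z) \<partial>P)"
    using cm Suc.prems \<delta> martingale_increment_cond_exp[OF mart]
    by (intro supersol_expectation_step[where K = "real n powr \<beta>"]) (auto simp: controlled_martingale_def)
  also have "\<dots> \<le> (s + 1 + real j) powr (- (\<delta> / 256)) / 128"
    using Suc.prems \<delta> by (intro Suc.IH) (auto simp: algebra_simps)
  finally show ?case by (simp add: algebra_simps)
qed

text \<open>Markov's inequality applied to \<open>supersol\<close>. The factor 2 dominates 129/128,
  and the summand 1 makes the bound on the supremum strict.\<close>

lemma localization_bound_exponent:
  fixes \<delta> \<beta> :: real
  assumes \<delta>: "0 < \<delta>" "\<delta> \<le> 1" and \<beta>: "0 \<le> \<beta>"
  shows "localization_bound TYPE('a) \<delta> \<beta> (2 * \<delta> powr (- (\<delta> / 256)) + 1) ((1 - 2 * \<beta>) * (\<delta> / 256))"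
  unfolding localization_bound_def
proof (intro allI impI)
  fix n :: nat and P :: "'a measure" and F M
  assume n: "1 \<le> n" and cm: "controlled_martingale \<delta> \<beta> n P F M"
  define \<alpha> where "\<alpha> = \<delta> / 256"
  define K where "K = real n powr \<beta>"
  \<comment> \<open>The smallest s allowed by the jump condition. As
    \<open>\<delta> \<le> 1\<close>, it is also at least the square of the window half-width
    \<open>K\<close>, as the lower bound on \<open>supersol\<close> demands.\<close>
  define s where "s = K\<^sup>2 / \<delta>"
  have mart: "martingale P F M" using cm by (simp add: controlled_martingale_def)
  interpret prob_space P using mart by (simp add: martingale_def)
  note [measurable] = martingale_borel_measurable[OF mart]
  have K: "1 \<le> K" unfolding K_def using n \<beta> by (simp add: ge_one_powr_ge_zero)
  have K2: "K\<^sup>2 = real n powr (2 * \<beta>)" unfolding K_def using n by (simp add: power2_eq_square powr_add[symmetric])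
  have K2_1: "1 \<le> K\<^sup>2" using K by (simp add: one_le_power)
  have sK: "K\<^sup>2 \<le> s" using \<delta> K2_1 unfolding s_def by (simp add: pos_le_divide_eq mult_left_le)
  hence s: "1 \<le> s" using K2_1 by linarith
  have bound: "measure P {\<omega> \<in> space P. \<bar>M n \<omega> - z\<bar> \<le> K} \<le> 2 * \<delta> powr (- \<alpha>) * real n powr (- ((1 - 2 * \<beta>) * \<alpha>))" for z
  proof -
    define A where "A = {\<omega> \<in> space P. \<bar>M n \<omega> - z\<bar> \<le> K}"
    have [measurable]: "A \<in> sets P" unfolding A_def by measurable
    have nn: "0 \<le> supersol \<alpha> s x" and le: "supersol \<alpha> s x \<le> s powr (- \<alpha>) / 128" for x
      using s by (auto intro!: supersol_nonneg supersol_le simp del: le_divide_eq_numeral1)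
    have int: "integrable P (\<lambda>\<omega>. supersol \<alpha> s (M n \<omega> - z))"
      using nn le by (intro integrable_const_bound[where B = "s powr (- \<alpha>) / 128"]) auto
    have "s powr (- \<alpha>) / 129 * measure P A = (\<integral>\<omega>. s powr (- \<alpha>) / 129 * indicator A \<omega> \<partial>P)"
      by simp
    also have "\<dots> \<le> (\<integral>\<omega>. supersol \<alpha> s (M n \<omega> - z) \<partial>P)"
    proof (intro integral_mono int)
      fix \<omega>
      show "s powr (- \<alpha>) / 129 * indicator A \<omega> \<le> supersol \<alpha> s (M n \<omega> - z)"
      proof (cases "\<omega> \<in> A")
        case True
        hence "(M n \<omega> - z)\<^sup>2 \<le> K\<^sup>2"
          unfolding A_def using K by (simp add: abs_le_square_iff[symmetric])
        thus ?thesis using True supersol_ge[of s "M n \<omega> - z" \<alpha>] sK s by simp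
      qed (simp add: nn)
      show "integrable P (\<lambda>\<omega>. s powr (- \<alpha>) / 129 * indicator A \<omega>)"
        by (intro integrable_mult_right integrable_real_indicator) (auto simp: emeasure_eq_measure)
    qed
    also have "\<dots> \<le> (s + real n) powr (- \<alpha>) / 128"
      unfolding \<alpha>_def using \<delta> s
      by (intro controlled_martingale_supersol_expectation[OF cm]) (auto simp: s_def K_def)
    also have "\<dots> \<le> real n powr (- \<alpha>) / 128"
      using n s \<delta> by (intro divide_right_mono powr_mono2') (auto simp: \<alpha>_def)
    finally have *: "s powr (- \<alpha>) / 129 * measure P A \<le> real n powr (- \<alpha>) / 128" .
    have sa: "s powr (- \<alpha>) * s powr \<alpha> = 1" using s by (simp add: powr_add[symmetric])
    have "measure P A = 129 * s powr \<alpha> * (s powr (- \<alpha>) / 129 * measure P A)"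
      using sa by (simp add: algebra_simps)
    also have "\<dots> \<le> 129 * s powr \<alpha> * (real n powr (- \<alpha>) / 128)"
      using * by (intro mult_left_mono) auto
    also have "\<dots> \<le> 2 * (s powr \<alpha> * real n powr (- \<alpha>))"
      by simp
    \<comment> \<open>Combined with the factor \<open>real n powr (- \<alpha>)\<close> this gives
      the exponent 2 \<beta> \<alpha> - \<alpha>.\<close>
    also have "s powr \<alpha> = \<delta> powr (- \<alpha>) * real n powr (2 * \<beta> * \<alpha>)"
      using \<delta> n by (simp add: s_def K2 powr_divide powr_powr powr_minus_divide)
    finally show ?thesis
      using powr_add[of "real n" "2 * \<beta> * \<alpha>" "- \<alpha>"] by (simp add: A_def algebra_simps)
  qed
  have "(SUP z. measure P {\<omega> \<in> space P. \<bar>M n \<omega> - z\<bar> \<le> K})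
      \<le> 2 * \<delta> powr (- \<alpha>) * real n powr (- ((1 - 2 * \<beta>) * \<alpha>))"
    by (rule cSUP_least) (auto intro: bound)
  also have "\<dots> < (2 * \<delta> powr (- \<alpha>) + 1) * real n powr (- ((1 - 2 * \<beta>) * \<alpha>))"
    using n by (intro mult_strict_right_mono) auto
  finally show "(SUP z. measure P {\<omega> \<in> space P. \<bar>M n \<omega> - z\<bar> \<le> real n powr \<beta>})
      < (2 * \<delta> powr (- (\<delta> / 256)) + 1) * real n powr (- ((1 - 2 * \<beta>) * (\<delta> / 256)))"
    by (simp add: \<alpha>_def K_def)
qed

section \<open>Transfer to the path space\<close>

definition paths :: "(nat \<Rightarrow> real) measure" where
  "paths = (\<Pi>\<^sub>M i\<in>UNIV. borel)"

text \<open>The natural filtration of the coordinate process. Its generators each involve one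
  coordinate, so measurability into it can be checked one time at a time.\<close>

definition path_filtration :: "nat \<Rightarrow> (nat \<Rightarrow> real) measure" where
  "path_filtration i = sigma UNIV {(\<lambda>w. w j) -` B | j B. j \<le> i \<and> B \<in> sets borel}"

section \<open>Measurability of the coordinate process\<close>

lemma space_paths [simp]: "space paths = UNIV"
  by (simp add: paths_def space_PiM)

lemma space_path_filtration [simp]: "space (path_filtration i) = UNIV"
  by (simp add: path_filtration_def)

lemma sets_path_filtration:
  "sets (path_filtration i) = sigma_sets UNIV {(\<lambda>w. w j) -` B | j B. j \<le> i \<and> B \<in> sets borel}"
  by (simp add: path_filtration_def)

lemma coordinate_measurable_paths [measurable]: "(\<lambda>w. w j) \<in> borel_measurable paths"
  unfolding paths_def by measurable

lemma coordinate_measurable_path_filtration: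
  assumes "j \<le> i"
  shows "(\<lambda>w. w j) \<in> borel_measurable (path_filtration i)"
  using assms by (auto simp: measurable_def sets_path_filtration)

lemma filtration_path_filtration: "filtration UNIV path_filtration"
proof
  fix i j :: nat
  assume "i \<le> j"
  thus "sets (path_filtration i) \<subseteq> sets (path_filtration j)"
    unfolding sets_path_filtration by (intro sigma_sets_mono') (auto intro: order_trans)
qed simp

lemma subalgebra_paths: "subalgebra paths (path_filtration i)"
proof -
  have "(\<lambda>w. w j) -` B \<in> sets paths" if "B \<in> sets borel" for j and B :: "real set"
    using measurable_sets[OF coordinate_measurable_paths that, of j] by simp
  hence "sigma_sets (space paths) {(\<lambda>w. w j) -` B | j B. j \<le> i \<and> B \<in> sets borel} \<subseteq> sets paths"
    by (intro sets.sigma_sets_subset) auto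
  thus ?thesis by (simp add: subalgebra_def sets_path_filtration)
qed

text \<open>The map records the whole path, but the target sigma-algebra sees only the times up to
  i. A generator at time j \<le> i pulls back into \<open>F j\<close>, hence into
  \<open>F i\<close>.\<close>

lemma measurable_path_filtration:
  assumes F: "filtration \<Omega> F" and M: "\<And>j. M j \<in> borel_measurable (F j)"
  shows "(\<lambda>\<omega> j. M j \<omega>) \<in> measurable (F i) (path_filtration i)"
proof (rule measurable_sigma_sets[OF sets_path_filtration])
  interpret filtration \<Omega> F by fact
  fix A :: "(nat \<Rightarrow> real) set"
  assume "A \<in> {(\<lambda>w. w j) -` B | j B. j \<le> i \<and> B \<in> sets borel}"
  then obtain j B where A: "A = (\<lambda>w. w j) -` B" "j \<le> i" "B \<in> sets borel" by auto
  have "M j -` B \<inter> space (F j) \<in> sets (F j)" using M A(3) by (rule measurable_sets)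
  hence "M j -` B \<inter> \<Omega> \<in> sets (F i)" using sets_F_mono[OF A(2)] by (auto simp: space_F)
  thus "(\<lambda>\<omega> j. M j \<omega>) -` A \<inter> space (F i) \<in> sets (F i)"
    by (simp add: A(1) space_F vimage_def)
qed auto

text \<open>Conditional expectations under the law are tested by integrals over coordinate events,
  and these pull back to integrals over events of \<open>F i\<close>, where the assumptions on
  \<open>M\<close> apply.\<close>

lemma controlled_martingale_path_law:
  assumes cm: "controlled_martingale \<delta> \<beta> n P F M"
  shows "controlled_martingale \<delta> \<beta> n (distr P paths (\<lambda>\<omega> j. M j \<omega>)) path_filtration (\<lambda>j w. w j)"
proof -
  define T where "T = (\<lambda>\<omega> j. M j \<omega>)"
  define Q where "Q = distr P paths T"
  define K where "K = real n powr \<beta>"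
  have mart: "martingale P F M" using cm by (simp add: controlled_martingale_def)
  interpret P: prob_space P using mart by (simp add: martingale_def)
  note M_meas [measurable] = martingale_borel_measurable[OF mart]
  have T [measurable]: "T \<in> measurable P paths"
    unfolding paths_def T_def by (rule measurable_PiM_single') auto
  interpret Q: prob_space Q unfolding Q_def by (rule P.prob_space_distr) fact
  have sQ [simp]: "space Q = UNIV" "sets Q = sets paths" by (auto simp: Q_def)
  have sub: "subalgebra Q (path_filtration i)" for i
    using subalgebra_paths[of i] by (simp add: subalgebra_def)
  interpret QF: finite_measure_subalgebra Q "path_filtration i" for i
    by standard (rule sub)
  interpret PF: finite_measure_subalgebra P "F i" for i
    using mart by (rule martingale_finite_measure_subalgebra)
  have cQ [measurable]: "(\<lambda>w. w j) \<in> borel_measurable Q" for j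
    by (simp add: Q_def)
  have filt: "filtration (space P) F" and adapted: "\<And>j. M j \<in> borel_measurable (F j)"
    using mart by (auto simp: martingale_def)
  \<comment> \<open>Key inclusion: path events up to time i become events of \<open>F i\<close>, so
    the defining property of conditional expectation given \<open>F i\<close> is available on
    them.\<close>
  have pull: "T -` A \<inter> space P \<in> sets (F i)" if "A \<in> sets (path_filtration i)" for A i
    using measurable_sets[OF measurable_path_filtration[OF filt adapted] that] filt
    by (simp add: T_def filtration.space_F)
  have set_int: "(\<integral>w\<in>A. f w \<partial>Q) = (\<integral>\<omega>\<in>T -` A \<inter> space P. f (T \<omega>) \<partial>P)"
    if "A \<in> sets (path_filtration i)" and [measurable]: "f \<in> borel_measurable paths"
    for A i and f :: "(nat \<Rightarrow> real) \<Rightarrow> real"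
  proof -
    have [measurable]: "A \<in> sets paths" using that(1) subalgebra_paths[of i] by (auto simp: subalgebra_def)
    have "(\<integral>w\<in>A. f w \<partial>Q) = (\<integral>\<omega>. indicator A (T \<omega>) * f (T \<omega>) \<partial>P)"
      unfolding set_lebesgue_integral_def Q_def by (simp add: integral_distr)
    also have "\<dots> = (\<integral>\<omega>\<in>T -` A \<inter> space P. f (T \<omega>) \<partial>P)"
      unfolding set_lebesgue_integral_def
      by (intro Bochner_Integration.integral_cong) (auto simp: indicator_def)
    finally show ?thesis .
  qed
  have intM: "integrable P (M i)" for i using mart by (auto simp: martingale_def)
  have intQ: "integrable Q (\<lambda>w. w i)" for i
    using intM[of i] unfolding Q_def by (subst integrable_distr_eq[OF T]) (auto simp: T_def)
  have martQ: "AE w in Q. real_cond_exp Q (path_filtration i) (\<lambda>w. w (Suc i)) w = w i" for i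
  proof (rule QF.real_cond_exp_charact)
    fix A assume A: "A \<in> sets (path_filtration i)"
    let ?B = "T -` A \<inter> space P"
    have "(\<integral>w\<in>A. w (Suc i) \<partial>Q) = (\<integral>\<omega>\<in>?B. M (Suc i) \<omega> \<partial>P)"
      using A by (subst set_int) (auto simp: T_def)
    also have "\<dots> = (\<integral>\<omega>\<in>?B. real_cond_exp P (F i) (M (Suc i)) \<omega> \<partial>P)"
      using PF.real_cond_exp_intA[OF intM pull[OF A]] .
    also have "\<dots> = (\<integral>\<omega>\<in>?B. M i \<omega> \<partial>P)"
    proof (rule set_lebesgue_integral_cong_AE)
      show "?B \<in> sets P" using pull[OF A] PF.subalg[of i] by (auto simp: subalgebra_def)
      show "AE \<omega>\<in>?B in P. real_cond_exp P (F i) (M (Suc i)) \<omega> = M i \<omega>"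
        using mart by (auto simp: martingale_def)
    qed auto
    also have "\<dots> = (\<integral>w\<in>A. w i \<partial>Q)"
      using A by (subst set_int) (auto simp: T_def)
    finally show "(\<integral>w\<in>A. w (Suc i) \<partial>Q) = (\<integral>w\<in>A. w i \<partial>Q)" .
  qed (auto intro: intQ coordinate_measurable_path_filtration)
  have bdP: "AE \<omega> in P. \<bar>M (Suc i) \<omega> - M i \<omega>\<bar> \<le> K" for i
    using cm by (auto simp: controlled_martingale_def K_def)
  have bdQ: "AE w in Q. \<bar>w (Suc i) - w i\<bar> \<le> K" for i
  proof -
    have "{w \<in> space paths. \<bar>w (Suc i) - w i\<bar> \<le> K} \<in> sets paths" by measurable
    thus ?thesis unfolding Q_def using bdP[of i] by (subst AE_distr_iff[OF T]) (auto simp: T_def)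
  qed
  have K0: "0 \<le> K" by (simp add: K_def)
  have intPsq: "integrable P (\<lambda>\<omega>. (M (Suc i) \<omega> - M i \<omega>)\<^sup>2)" for i
  proof (rule P.integrable_const_bound)
    show "AE \<omega> in P. norm ((M (Suc i) \<omega> - M i \<omega>)\<^sup>2) \<le> K\<^sup>2"
      using bdP[of i] by eventually_elim (use K0 in \<open>simp add: abs_le_square_iff[symmetric]\<close>)
  qed measurable
  have intQsq: "integrable Q (\<lambda>w. (w (Suc i) - w i)\<^sup>2)" for i
  proof (rule Q.integrable_const_bound)
    show "AE w in Q. norm ((w (Suc i) - w i)\<^sup>2) \<le> K\<^sup>2"
      using bdQ[of i] by eventually_elim (use K0 in \<open>simp add: abs_le_square_iff[symmetric]\<close>)
  qed measurable
  have varP: "AE \<omega> in P. real_cond_exp P (F i) (\<lambda>\<omega>. (M (Suc i) \<omega> - M i \<omega>)\<^sup>2) \<omega> \<in> {\<delta>..1}" for i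
    using cm by (auto simp: controlled_martingale_def)
  have varQ: "AE w in Q. real_cond_exp Q (path_filtration i) (\<lambda>w. (w (Suc i) - w i)\<^sup>2) w \<in> {\<delta>..1}" for i
  proof -
    let ?V = "real_cond_exp P (F i) (\<lambda>\<omega>. (M (Suc i) \<omega> - M i \<omega>)\<^sup>2)"
    \<comment> \<open>The filtration \<open>F\<close> may be finer than the one generated by
      \<open>M\<close>, so the conditional variance itself need not carry over; its bounds do, since
      averaging over fewer events preserves the interval from \<delta> to 1.\<close>
    have bounds: "(\<integral>w\<in>A. \<delta> \<partial>Q) \<le> (\<integral>w\<in>A. (w (Suc i) - w i)\<^sup>2 \<partial>Q)"
      "(\<integral>w\<in>A. (w (Suc i) - w i)\<^sup>2 \<partial>Q) \<le> (\<integral>w\<in>A. 1 \<partial>Q)"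
      if A: "A \<in> sets (path_filtration i)" for A
    proof -
      let ?B = "T -` A \<inter> space P"
      have B: "?B \<in> sets P" using pull[OF A] PF.subalg[of i] by (auto simp: subalgebra_def)
      have "(\<integral>w\<in>A. (w (Suc i) - w i)\<^sup>2 \<partial>Q) = (\<integral>\<omega>\<in>?B. (M (Suc i) \<omega> - M i \<omega>)\<^sup>2 \<partial>P)"
        using A by (subst set_int) (auto simp: T_def)
      also have "\<dots> = (\<integral>\<omega>\<in>?B. ?V \<omega> \<partial>P)"
        using PF.real_cond_exp_intA[OF intPsq pull[OF A]] .
      finally have eq: "(\<integral>w\<in>A. (w (Suc i) - w i)\<^sup>2 \<partial>Q) = (\<integral>\<omega>\<in>?B. ?V \<omega> \<partial>P)" .
      have const: "(\<integral>w\<in>A. c \<partial>Q) = (\<integral>\<omega>\<in>?B. c \<partial>P)" for c :: real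
        using A by (subst set_int) auto
      have iV: "set_integrable P ?B ?V" and ic: "set_integrable P ?B (\<lambda>_. c)" for c :: real
        unfolding set_integrable_def
        by (intro integrable_mult_indicator[OF B] PF.real_cond_exp_int intPsq P.integrable_const)+
      have "(\<integral>\<omega>\<in>?B. \<delta> \<partial>P) \<le> (\<integral>\<omega>\<in>?B. ?V \<omega> \<partial>P)"
        using varP[of i] by (intro set_integral_mono_AE ic iV) auto
      thus "(\<integral>w\<in>A. \<delta> \<partial>Q) \<le> (\<integral>w\<in>A. (w (Suc i) - w i)\<^sup>2 \<partial>Q)" by (simp only: eq const)
      have "(\<integral>\<omega>\<in>?B. ?V \<omega> \<partial>P) \<le> (\<integral>\<omega>\<in>?B. 1 \<partial>P)"
        using varP[of i] by (intro set_integral_mono_AE ic iV) auto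
      thus "(\<integral>w\<in>A. (w (Suc i) - w i)\<^sup>2 \<partial>Q) \<le> (\<integral>w\<in>A. 1 \<partial>Q)" by (simp only: eq const)
    qed
    let ?W = "real_cond_exp Q (path_filtration i) (\<lambda>w. (w (Suc i) - w i)\<^sup>2)"
    have "AE w in Q. real_cond_exp Q (path_filtration i) (\<lambda>_. \<delta>) w \<le> ?W w"
      using bounds(1) by (intro QF.real_cond_exp_mono_set intQsq) auto
    moreover have "AE w in Q. ?W w \<le> real_cond_exp Q (path_filtration i) (\<lambda>_. 1) w"
      using bounds(2) by (intro QF.real_cond_exp_mono_set intQsq) auto
    moreover have "AE w in Q. real_cond_exp Q (path_filtration i) (\<lambda>_. c) w = c" for c :: real
      by (intro QF.real_cond_exp_F_meas) auto
    note this[of \<delta>] this[of 1]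
    ultimately show ?thesis by eventually_elim auto
  qed
  have "martingale Q path_filtration (\<lambda>j w. w j)"
    unfolding martingale_def
    using Q.prob_space_axioms filtration_path_filtration sub intQ martQ
    by (auto intro: coordinate_measurable_path_filtration)
  thus ?thesis
    using varQ bdQ unfolding controlled_martingale_def Q_def[symmetric] T_def[symmetric] K_def[symmetric] by auto
qed

text \<open>The probability of each window for \<open>M n\<close> depends only on the law of the
  path, so the assumed bound for that law is the bound for \<open>P\<close>.\<close>

lemma localization_bound_transfer:
  assumes "localization_bound TYPE(nat \<Rightarrow> real) \<delta> \<beta> C \<alpha>"
  shows "localization_bound TYPE('a) \<delta> \<beta> C \<alpha>"
  unfolding localization_bound_def
proof (intro allI impI)
  fix n :: nat and P :: "'a measure" and F M
  assume n: "1 \<le> n" and cm: "controlled_martingale \<delta> \<beta> n P F M"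
  have mart: "martingale P F M" using cm by (simp add: controlled_martingale_def)
  note [measurable] = martingale_borel_measurable[OF mart]
  let ?T = "\<lambda>\<omega> j. M j \<omega>"
  have [measurable]: "?T \<in> measurable P paths"
    unfolding paths_def by (rule measurable_PiM_single') auto
  have "measure (distr P paths ?T) {w \<in> space (distr P paths ?T). \<bar>w n - z\<bar> \<le> real n powr \<beta>}
      = measure P {\<omega> \<in> space P. \<bar>M n \<omega> - z\<bar> \<le> real n powr \<beta>}" for z
  proof -
    have "{w \<in> space paths. \<bar>w n - z\<bar> \<le> real n powr \<beta>} \<in> sets paths" by measurable
    thus ?thesis by (simp add: measure_distr vimage_def Int_def conj_commute)
  qed
  thus "(SUP z. measure P {\<omega> \<in> space P. \<bar>M n \<omega> - z\<bar> \<le> real n powr \<beta>}) < C * real n powr (- \<alpha>)"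
    using assms n controlled_martingale_path_law[OF cm] unfolding localization_bound_def by fastforce
qed

theorem theorem1:
  fixes \<delta> \<beta> :: real
  assumes "0 < \<delta>" and "\<delta> \<le> 1" and "0 \<le> \<beta>" and "\<beta> < 1/2"
  shows "(\<exists>C \<alpha>. 0 < \<alpha> \<and> localization_bound TYPE(nat \<Rightarrow> real) \<delta> \<beta> C \<alpha>) \<and>
         (\<forall>C \<alpha>. 0 < \<alpha> \<and> localization_bound TYPE(nat \<Rightarrow> real) \<delta> \<beta> C \<alpha>
            \<longrightarrow> localization_bound TYPE('a) \<delta> \<beta> C \<alpha>)"
proof (intro conjI allI impI)
  \<comment> \<open>The assumption \<beta> < 1/2 makes the exponent witness positive.\<close>
  show "\<exists>C \<alpha>. 0 < \<alpha> \<and> localization_bound TYPE(nat \<Rightarrow> real) \<delta> \<beta> C \<alpha>"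
    using assms localization_bound_exponent[OF assms(1-3)]
    by (intro exI[of _ "2 * \<delta> powr (- (\<delta> / 256)) + 1"] exI[of _ "(1 - 2 * \<beta>) * (\<delta> / 256)"]) auto
  fix C \<alpha>
  assume "0 < \<alpha> \<and> localization_bound TYPE(nat \<Rightarrow> real) \<delta> \<beta> C \<alpha>"
  thus "localization_bound TYPE('a) \<delta> \<beta> C \<alpha>" by (blast intro: localization_bound_transfer)
qed

end
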